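(* Let $n\ge1$, let $m$ be the (normalized) Haar measure on the orthogonal group $O(n)$, and let $\nu$ be a rotation invariant Borel probability measure on $\mathbb{R}^n$. Let $A,B\subset\mathbb{R}^n$ be two Borel sets which are star shaped with $0$ being a center. Then $$\int_{O(n)}\nu(A\cap U(B))\,dm(U)\ \ge\ \nu(A)\,\nu(B).$$
   Context: $O(n)$ is the group of real orthogonal $n\times n$ matrices, and $m$ is normalized so that $m(O(n))=1$. Rotation invariant means $\nu(U(C))=\nu(C)$ for every Borel set $C$ and every $U\in O(n)$. A set $A\subset\mathbb{R}^n$ is star shaped with $0$ being a center if for every $\theta$ in the unit sphere $S^{n-1}=\{x\in\mathbb{R}^n:|x|=1\}$ the set $\{r\ge0: r\theta\in A\}$ is an interval containing $0$. *)

theory Defs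
  imports "HOL-Probability.Probability"
begin

definition orthogonal_group :: "(real ^ 'n ^ 'n) set" where
  "orthogonal_group = {U. orthogonal_matrix U}"

text \<open>
  Haar probability measure on the Borel sets of the orthogonal group, which carries the
  subspace topology of the space of matrices. Only left invariance is required; as the group
  is compact, right invariance and regularity follow, and these conditions determine the
  measure uniquely.
\<close>

definition normalized_haar_measure :: "(real ^ 'n ^ 'n) measure \<Rightarrow> bool" where
  "normalized_haar_measure m \<longleftrightarrow>
     sets m = sets (restrict_space borel orthogonal_group) \<and>
     emeasure m orthogonal_group = 1 \<and>
     (\<forall>V\<in>orthogonal_group. \<forall>C\<in>sets m. emeasure m ((\<lambda>U. V ** U) ` C) = emeasure m C)"

definition rotation_invariant :: "(real ^ 'n) measure \<Rightarrow> bool" where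
  "rotation_invariant \<nu> \<longleftrightarrow>
     (\<forall>U\<in>orthogonal_group. \<forall>C\<in>sets borel. emeasure \<nu> ((\<lambda>x. U *v x) ` C) = emeasure \<nu> C)"

definition star_shaped_zero :: "(real ^ 'n) set \<Rightarrow> bool" where
  "star_shaped_zero A \<longleftrightarrow>
     (\<forall>\<theta>\<in>sphere 0 1. is_interval {r. 0 \<le> r \<and> r *\<^sub>R \<theta> \<in> A} \<and> 0 \<in> {r. 0 \<le> r \<and> r *\<^sub>R \<theta> \<in> A})"

end

theory Submission imports Defs begin

text \<open>
  Averaging the indicator of a star shaped set over the rotations of a point \<open>x\<close> gives a function
  of \<open>x\<close> that is radial, because \<open>m\<close> is left invariant and \<open>O(n)\<close> is transitive on spheres, and
  nonincreasing in the norm of \<open>x\<close>. By Fubini and the invariance of \<open>\<nu>\<close>, the left-hand side is the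
  \<open>\<nu>\<close>-integral of the product of the averages of \<open>A\<close> and \<open>B\<close>, and Chebyshev's inequality for
  similarly ordered functions bounds it below by the product of the two integrals.
\<close>

text \<open>Products stay in the form \<open>transpose U *v x\<close>, which the lemmas below match;
  this rule would turn them into vector-matrix products.\<close>

declare transpose_matrix_vector [simp del]

text \<open>Integrate the ordering hypothesis over two independent copies of the variable. Doing
  this first in \<open>y\<close> with \<open>x\<close> fixed and then in \<open>x\<close> needs only
  single integrals, and the result is twice the claim.\<close>

lemma (in prob_space) chebyshev_integral_inequality:
  fixes f g :: "'a \<Rightarrow> real"
  assumes f: "integrable M f" and g: "integrable M g" and fg: "integrable M (\<lambda>x. f x * g x)"
    and ord: "\<And>x y. x \<in> space M \<Longrightarrow> y \<in> space M \<Longrightarrow> 0 \<le> (f x - f y) * (g x - g y)"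
  shows "(LINT x|M. f x) * (LINT x|M. g x) \<le> (LINT x|M. f x * g x)"
proof -
  define F G I where "F = (LINT x|M. f x)" and "G = (LINT x|M. g x)"
    and "I = (LINT x|M. f x * g x)"
  have pointwise: "0 \<le> f x * g x - f x * G - g x * F + I" if "x \<in> space M" for x
  proof -
    have "0 \<le> (LINT y|M. (f x - f y) * (g x - g y))"
      using ord that by (intro integral_nonneg_AE) auto
    also have "\<dots> = (LINT y|M. f x * g x - f x * g y - g x * f y + f y * g y)"
      by (simp add: algebra_simps)
    also have "\<dots> = f x * g x - f x * G - g x * F + I"
      using f g fg by (simp add: F_def G_def I_def prob_space)
    finally show ?thesis .
  qed
  have "0 \<le> (LINT x|M. f x * g x - f x * G - g x * F + I)"
    using pointwise by (intro integral_nonneg_AE) auto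
  also have "\<dots> = I - F * G - G * F + I"
    using f g fg by (simp add: F_def G_def I_def prob_space)
  finally show ?thesis by (simp add: F_def G_def I_def)
qed

text \<open>The admissible radii on the ray through \<open>x\<close> form an interval containing 0
  and \<open>norm x\<close>, hence also \<open>t * norm x\<close>. Later arguments use star
  shapedness only in this form.\<close>

lemma star_shaped_zero_scale:
  fixes A :: "(real ^ 'n) set"
  assumes A: "star_shaped_zero A" and x: "x \<in> A" and t: "0 \<le> t" "t \<le> 1"
  shows "t *\<^sub>R x \<in> A"
proof (cases "x = 0")
  case False
  define R where "R = {r. 0 \<le> r \<and> r *\<^sub>R (x /\<^sub>R norm x) \<in> A}"
  have "x /\<^sub>R norm x \<in> sphere 0 1" using False by simp
  then have "is_interval R" and "0 \<in> R"
    using A unfolding star_shaped_zero_def R_def by blast+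
  moreover have "norm x \<in> R" using False x by (simp add: R_def)
  moreover have "0 \<le> t * norm x" "t * norm x \<le> norm x"
    using t by (auto simp: mult_left_le_one_le)
  ultimately have "t * norm x \<in> R" unfolding is_interval_1 by blast
  then show ?thesis using False by (simp add: R_def mult.assoc)
qed (use x in simp)

section \<open>Orthogonal matrices acting on vectors\<close>

lemma orthogonal_group_transitive_on_spheres:
  fixes x y :: "real ^ 'n"
  assumes "norm x = norm y"
  obtains V where "V \<in> orthogonal_group" and "V *v x = y"
proof -
  obtain f where f: "orthogonal_transformation f" "f x = y"
    using orthogonal_transformation_exists[OF assms] by blast
  then have "matrix f \<in> orthogonal_group" "matrix f *v x = y"
    by (auto simp: orthogonal_group_def orthogonal_transformation_matrix matrix_works
        orthogonal_transformation_linear)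
  then show ?thesis using that by blast
qed

lemma transpose_orthogonal_group:
  "U \<in> orthogonal_group \<Longrightarrow> transpose U \<in> orthogonal_group"
  by (simp add: orthogonal_group_def orthogonal_matrix_transpose)

lemma orthogonal_group_mult:
  "U \<in> orthogonal_group \<Longrightarrow> V \<in> orthogonal_group \<Longrightarrow> U ** V \<in> orthogonal_group"
  by (simp add: orthogonal_group_def orthogonal_matrix_mul)

lemma orthogonal_group_cancel:
  assumes "U \<in> orthogonal_group"
  shows "U ** transpose U = mat 1" "transpose U ** U = mat 1"
    "U ** (transpose U ** W) = W" "transpose U ** (U ** W) = W"
    "U *v (transpose U *v x) = x" "transpose U *v (U *v x) = x"
  using assms by (auto simp: orthogonal_group_def orthogonal_matrix_def
      matrix_mul_assoc matrix_vector_mul_assoc)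

text \<open>A preimage under a continuous map is visibly Borel, and its indicator is a composition;
  both help when \<open>U\<close> varies.\<close>

lemma orthogonal_group_image_eq:
  assumes "U \<in> orthogonal_group"
  shows "(\<lambda>x. U *v x) ` B = {x. transpose U *v x \<in> B}"
proof (intro equalityI subsetI)
  fix x assume "x \<in> {x. transpose U *v x \<in> B}"
  then show "x \<in> (\<lambda>x. U *v x) ` B"
    by (intro image_eqI[where x = "transpose U *v x"]) (auto simp: orthogonal_group_cancel assms)
qed (auto simp: orthogonal_group_cancel assms)

lemma borel_measurable_mult_vec:
  fixes M :: "real ^ 'n ^ 'm"
  shows "(\<lambda>x. M *v x) \<in> borel_measurable borel"
  by (intro borel_measurable_continuous_onI linear_continuous_on)
    (simp add: linear_linear matrix_vector_mul_linear)

text \<open>The entries of the product are polynomials in those of \<open>U\<close> and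
  \<open>x\<close>, so the map is jointly continuous; by second countability the product of the
  Borel algebras is the Borel algebra of the product.\<close>

lemma borel_measurable_transpose_mult_vec:
  "(\<lambda>(U :: real ^ 'n ^ 'n, x :: real ^ 'n). transpose U *v x) \<in> borel \<Otimes>\<^sub>M borel \<rightarrow>\<^sub>M borel"
  unfolding borel_prod case_prod_beta
proof (intro borel_measurable_continuous_onI)
  show "continuous_on UNIV (\<lambda>p :: (real ^ 'n ^ 'n) \<times> (real ^ 'n). transpose (fst p) *v snd p)"
    unfolding matrix_vector_mult_def transpose_def
    by (auto intro!: continuous_intros)
qed

section \<open>Haar measure paired with a rotation invariant measure\<close>

locale haar_rotation = pair_prob_space m \<nu>
  for m :: "(real ^ 'n ^ 'n) measure" and \<nu> :: "(real ^ 'n) measure" +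
  assumes haar: "normalized_haar_measure m"
    and sets_nu: "sets \<nu> = sets borel"
    and rotation: "rotation_invariant \<nu>"
begin

lemma sets_haar: "sets m = sets (restrict_space borel orthogonal_group)"
  using haar by (simp add: normalized_haar_measure_def)

lemma space_haar: "space m = orthogonal_group"
  using sets_eq_imp_space_eq[OF sets_haar] by (simp add: space_restrict_space)

lemma space_nu: "space \<nu> = UNIV"
  using sets_eq_imp_space_eq[OF sets_nu] by simp

lemma borel_measurable_nu: "f \<in> borel_measurable borel \<Longrightarrow> f \<in> borel_measurable \<nu>"
  using measurable_cong_sets[OF sets_nu refl] by blast

lemma measurable_transpose_mult_vec:
  "(\<lambda>(U, x). transpose U *v x) \<in> m \<Otimes>\<^sub>M \<nu> \<rightarrow>\<^sub>M borel"
proof -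
  have fst: "fst \<in> m \<Otimes>\<^sub>M \<nu> \<rightarrow>\<^sub>M borel"
    using measurable_restrict_space1[OF measurable_ident]
    by (intro measurable_compose[OF measurable_fst])
      (auto simp: measurable_cong_sets[OF sets_haar refl] id_def)
  have snd: "snd \<in> m \<Otimes>\<^sub>M \<nu> \<rightarrow>\<^sub>M borel"
    using measurable_snd measurable_cong_sets[OF refl sets_nu] by blast
  have "(\<lambda>p. (fst p, snd p)) \<in> m \<Otimes>\<^sub>M \<nu> \<rightarrow>\<^sub>M borel \<Otimes>\<^sub>M borel"
    using fst snd by (rule measurable_Pair)
  from measurable_compose[OF this borel_measurable_transpose_mult_vec] show ?thesis
    by (simp add: case_prod_beta)
qed

section \<open>Averages of a set over rotations\<close>

lemma transpose_mult_vec_preimage_sets: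
  assumes "S \<in> sets borel"
  shows "{U \<in> orthogonal_group. transpose U *v x \<in> S} \<in> sets m"
proof -
  have "(\<lambda>U. transpose U *v x) \<in> m \<rightarrow>\<^sub>M borel"
    using measurable_Pair_compose_split[OF measurable_transpose_mult_vec, of id m "\<lambda>_. x"] space_nu
    by simp
  from measurable_sets[OF this assms] show ?thesis
    by (simp add: space_haar vimage_def Int_def conj_commute)
qed

text \<open>The condition says that \<open>x\<close> lies in the rotated set U(S), so this is the
  chance that a Haar-random copy of \<open>S\<close> covers \<open>x\<close>. With the transpose
  acting on \<open>x\<close>, moving \<open>x\<close> by \<open>V\<close> translates the set of such
  \<open>U\<close> on the left, which matches the invariance assumed of \<open>m\<close>.\<close>

definition rotation_average :: "(real ^ 'n) set \<Rightarrow> real ^ 'n \<Rightarrow> real" where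
  "rotation_average S x = measure m {U \<in> orthogonal_group. transpose U *v x \<in> S}"

text \<open>Since \<open>transpose U *v (V *v x)\<close> equals
  \<open>transpose (transpose V ** U) *v x\<close>, the set of matrices belonging to
  \<open>V *v x\<close> is the left translate by \<open>V\<close> of the one belonging to
  \<open>x\<close>.\<close>

lemma rotation_average_rotate:
  assumes S: "S \<in> sets borel" and V: "V \<in> orthogonal_group"
  shows "rotation_average S (V *v x) = rotation_average S x"
proof -
  let ?C = "\<lambda>x. {U \<in> orthogonal_group. transpose U *v x \<in> S}"
  have "?C (V *v x) = (\<lambda>U. V ** U) ` ?C x"
  proof (intro equalityI subsetI)
    fix U assume "U \<in> ?C (V *v x)"
    then have "transpose V ** U \<in> ?C x"
      using V by (simp add: orthogonal_group_mult transpose_orthogonal_group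
          matrix_transpose_mul matrix_vector_mul_assoc)
    then show "U \<in> (\<lambda>U. V ** U) ` ?C x"
      using V by (intro image_eqI[where x = "transpose V ** U"]) (simp_all add: orthogonal_group_cancel)
  next
    fix U assume "U \<in> (\<lambda>U. V ** U) ` ?C x"
    then show "U \<in> ?C (V *v x)"
      using V by (auto simp: orthogonal_group_mult matrix_transpose_mul orthogonal_group_cancel
          simp flip: matrix_vector_mul_assoc)
  qed
  moreover have "emeasure m ((\<lambda>U. V ** U) ` ?C x) = emeasure m (?C x)"
    using haar V transpose_mult_vec_preimage_sets[OF S]
    by (simp add: normalized_haar_measure_def)
  ultimately show ?thesis
    by (simp add: rotation_average_def measure_def)
qed

text \<open>Shrink \<open>y\<close> along its ray to the norm of \<open>x\<close>, which by star
  shapedness only enlarges the set of good matrices, then rotate the result onto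
  \<open>x\<close>.\<close>

lemma rotation_average_antimono:
  assumes S: "S \<in> sets borel" "star_shaped_zero S" and le: "norm x \<le> norm y"
  shows "rotation_average S y \<le> rotation_average S x"
proof -
  \<comment> \<open>If \<open>y = 0\<close> then \<open>x = 0\<close> as well, so the value 0 still
    gives \<open>t *\<^sub>R y\<close> the norm of \<open>x\<close>.\<close>
  define t where "t = (if y = 0 then 0 else norm x / norm y)"
  have t: "0 \<le> t" "t \<le> 1" and "norm (t *\<^sub>R y) = norm x"
    using le by (auto simp: t_def divide_simps)
  then obtain V where V: "V \<in> orthogonal_group" "V *v (t *\<^sub>R y) = x"
    using orthogonal_group_transitive_on_spheres by metis
  have "rotation_average S y \<le> rotation_average S (t *\<^sub>R y)"
    unfolding rotation_average_def
    using star_shaped_zero_scale[OF S(2) _ t]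
    by (intro M1.finite_measure_mono transpose_mult_vec_preimage_sets S(1))
      (auto simp: matrix_vector_mult_scaleR)
  also have "\<dots> = rotation_average S x"
    using rotation_average_rotate[OF S(1) V(1)] V(2) by metis
  finally show ?thesis .
qed

lemma rotation_average_similarly_ordered:
  assumes "A \<in> sets borel" "star_shaped_zero A" "B \<in> sets borel" "star_shaped_zero B"
  shows "0 \<le> (rotation_average A x - rotation_average A y)
    * (rotation_average B x - rotation_average B y)"
proof (cases "norm x \<le> norm y")
  case True
  then show ?thesis
    using assms rotation_average_antimono[of _ x y] by (intro mult_nonneg_nonneg) auto
next
  case False
  then show ?thesis
    using assms rotation_average_antimono[of _ y x] by (intro mult_nonpos_nonpos) auto
qed

section \<open>Integrals of averages\<close>

lemma rotation_average_integral:
  assumes "S \<in> sets borel"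
  shows "rotation_average S x = (LINT U|m. indicator S (transpose U *v x))"
proof -
  have "(LINT U|m. indicator S (transpose U *v x))
      = (LINT U|m. indicator {U \<in> orthogonal_group. transpose U *v x \<in> S} U :: real)"
    by (intro Bochner_Integration.integral_cong) (auto simp: space_haar indicator_def)
  also have "\<dots> = rotation_average S x"
    using transpose_mult_vec_preimage_sets[OF assms]
    by (simp add: rotation_average_def)
  finally show ?thesis by simp
qed

lemma indicator_rotation_measurable:
  assumes "S \<in> sets borel"
  shows "(\<lambda>(U, x). indicator S (transpose U *v x) :: real) \<in> borel_measurable (m \<Otimes>\<^sub>M \<nu>)"
  using measurable_compose[OF measurable_transpose_mult_vec borel_measurable_indicator[OF assms]]
  by (simp add: case_prod_beta')

lemma rotation_average_measurable:
  assumes S: "S \<in> sets borel"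
  shows "rotation_average S \<in> borel_measurable \<nu>"
proof -
  have "(\<lambda>x. LINT U|m. indicator S (transpose U *v x) :: real) \<in> borel_measurable \<nu>"
    using measurable_pair_swap[OF indicator_rotation_measurable[OF S]]
    by (intro M1.borel_measurable_lebesgue_integral) simp
  then show ?thesis
    by (simp add: rotation_average_integral[OF S] cong: measurable_cong)
qed

lemma rotation_average_bound: "\<bar>rotation_average S x\<bar> \<le> 1"
  by (simp add: rotation_average_def)

text \<open>Fubini for a bounded weight \<open>k\<close>. The weight need not be radial, so it may
  be the indicator of the other set.\<close>

lemma integral_rotation_average:
  assumes S: "S \<in> sets borel" and k: "k \<in> borel_measurable \<nu>"
    and bound: "\<And>x. \<bar>k x\<bar> \<le> (1 :: real)"
  shows "(LINT U|m. LINT x|\<nu>. indicator S (transpose U *v x) * k x)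
    = (LINT x|\<nu>. rotation_average S x * k x)"
proof -
  have "(\<lambda>(U, x). indicator S (transpose U *v x) * k x) \<in> borel_measurable (m \<Otimes>\<^sub>M \<nu>)"
    using borel_measurable_times[OF indicator_rotation_measurable[OF S]
        measurable_compose[OF measurable_snd k]]
    by (simp add: case_prod_beta')
  then have "integrable (m \<Otimes>\<^sub>M \<nu>) (\<lambda>(U, x). indicator S (transpose U *v x) * k x)"
    using bound by (intro P.integrable_const_bound[where B = 1]) (auto simp: indicator_def)
  from Fubini_integral[OF this] show ?thesis
    by (simp add: rotation_average_integral[OF S])
qed

text \<open>Invariance restated as a pushforward, which permits a change of variables in integrals:
  the preimage of a set under the transpose is its image under \<open>U\<close>.\<close>

lemma distr_rotation:
  assumes U: "U \<in> orthogonal_group"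
  shows "distr \<nu> borel (\<lambda>x. transpose U *v x) = \<nu>"
proof (rule measure_eqI)
  fix S assume "S \<in> sets (distr \<nu> borel (\<lambda>x. transpose U *v x))"
  then have S: "S \<in> sets borel" by simp
  have meas: "(\<lambda>x. transpose U *v x) \<in> \<nu> \<rightarrow>\<^sub>M borel"
    by (intro borel_measurable_nu borel_measurable_mult_vec)
  have "emeasure (distr \<nu> borel (\<lambda>x. transpose U *v x)) S = emeasure \<nu> ((\<lambda>x. U *v x) ` S)"
    using S meas by (simp add: emeasure_distr orthogonal_group_image_eq[OF U] vimage_def space_nu)
  also have "\<dots> = emeasure \<nu> S"
    using rotation U S by (simp add: rotation_invariant_def)
  finally show "emeasure (distr \<nu> borel (\<lambda>x. transpose U *v x)) S = emeasure \<nu> S" .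
qed (simp add: sets_nu)

text \<open>Substituting \<open>transpose U *v x\<close> for \<open>x\<close> changes neither
  \<open>\<nu>\<close> nor the radial \<open>k\<close>, so the left side equals its own average over
  \<open>U\<close>; Fubini then moves that average onto the indicator. The weight 1 recovers the
  measure of \<open>S\<close>.\<close>

lemma integral_indicator_radial:
  assumes S: "S \<in> sets borel" and k: "k \<in> borel_measurable borel"
    and bound: "\<And>x. \<bar>k x\<bar> \<le> (1 :: real)"
    and radial: "\<And>U x. U \<in> orthogonal_group \<Longrightarrow> k (U *v x) = k x"
  shows "(LINT x|\<nu>. indicator S x * k x) = (LINT x|\<nu>. rotation_average S x * k x)"
proof -
  have "(LINT x|\<nu>. indicator S (transpose U *v x) * k x) = (LINT x|\<nu>. indicator S x * k x)"
    if U: "U \<in> orthogonal_group" for U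
  proof -
    have meas: "(\<lambda>x. transpose U *v x) \<in> \<nu> \<rightarrow>\<^sub>M borel"
      by (intro borel_measurable_nu borel_measurable_mult_vec)
    have "(LINT x|\<nu>. indicator S x * k x)
        = (LINT x|distr \<nu> borel (\<lambda>x. transpose U *v x). indicator S x * k x)"
      by (simp add: distr_rotation[OF U])
    also have "\<dots> = (LINT x|\<nu>. indicator S (transpose U *v x) * k (transpose U *v x))"
      using S k by (intro integral_distr meas) simp
    finally show ?thesis by (simp add: radial[OF transpose_orthogonal_group[OF U]])
  qed
  then have "(LINT U|m. LINT x|\<nu>. indicator S (transpose U *v x) * k x)
      = (LINT U|m. LINT x|\<nu>. indicator S x * k x)"
    by - (rule Bochner_Integration.integral_cong[OF refl], simp only: space_haar)
  then show ?thesis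
    using integral_rotation_average[OF S borel_measurable_nu[OF k] bound]
    by (simp add: M1.prob_space)
qed

lemma integral_rotation_average_eq_measure:
  assumes S: "S \<in> sets borel"
  shows "(LINT x|\<nu>. rotation_average S x) = measure \<nu> S"
  using integral_indicator_radial[OF S, of "\<lambda>_. 1"] S by (simp add: sets_nu space_nu)

lemma integral_measure_Int_rotation:
  assumes A: "A \<in> sets borel" and B: "B \<in> sets borel"
  shows "(LINT U|m. measure \<nu> (A \<inter> (\<lambda>x. U *v x) ` B))
    = (LINT x|\<nu>. rotation_average A x * rotation_average B x)"
proof -
  have "measure \<nu> (A \<inter> (\<lambda>x. U *v x) ` B)
      = (LINT x|\<nu>. indicator B (transpose U *v x) * indicator A x)" if "U \<in> orthogonal_group" for U
  proof -
    have "(\<lambda>x. U *v x) ` B = (\<lambda>x. transpose U *v x) -` B \<inter> space borel"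
      by (auto simp: orthogonal_group_image_eq[OF that])
    also have "\<dots> \<in> sets borel"
      using measurable_sets[OF borel_measurable_mult_vec B] .
    finally have "measure \<nu> (A \<inter> (\<lambda>x. U *v x) ` B)
        = (LINT x|\<nu>. indicator (A \<inter> (\<lambda>x. U *v x) ` B) x)"
      using A by (simp add: sets_nu space_nu)
    also have "\<dots> = (LINT x|\<nu>. indicator B (transpose U *v x) * indicator A x)"
      by (intro Bochner_Integration.integral_cong)
        (auto simp: orthogonal_group_image_eq[OF that] indicator_def)
    finally show ?thesis .
  qed
  then have "(LINT U|m. measure \<nu> (A \<inter> (\<lambda>x. U *v x) ` B))
      = (LINT U|m. LINT x|\<nu>. indicator B (transpose U *v x) * indicator A x)"
    by (intro Bochner_Integration.integral_cong) (simp_all add: space_haar)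
  \<comment> \<open>The indicator of \<open>A\<close> is a fixed weight here, so Fubini alone
    averages \<open>B\<close>.\<close>
  also have "\<dots> = (LINT x|\<nu>. indicator A x * rotation_average B x)"
    using integral_rotation_average[OF B, of "indicator A"] A
    by (simp add: borel_measurable_nu mult.commute indicator_def)
  \<comment> \<open>The average of \<open>B\<close> is radial, so it can serve as the weight against
    which \<open>A\<close> is averaged too.\<close>
  also have "\<dots> = (LINT x|\<nu>. rotation_average A x * rotation_average B x)"
    using rotation_average_measurable[OF B]
    by (intro integral_indicator_radial A rotation_average_bound rotation_average_rotate B)
      (simp_all add: measurable_cong_sets[OF sets_nu refl])
  finally show ?thesis .
qed

lemma integral_measure_Int_rotation_ge:
  assumes A: "A \<in> sets borel" "star_shaped_zero A" and B: "B \<in> sets borel" "star_shaped_zero B"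
  shows "measure \<nu> A * measure \<nu> B \<le> (LINT U|m. measure \<nu> (A \<inter> (\<lambda>x. U *v x) ` B))"
proof -
  note [measurable] = rotation_average_measurable[OF A(1)] rotation_average_measurable[OF B(1)]
  \<comment> \<open>On a probability space this bound yields the integrability of the product that
    Chebyshev's inequality asks for.\<close>
  have "\<bar>rotation_average A x * rotation_average B x\<bar> \<le> 1" for x
    unfolding abs_mult by (intro mult_le_one rotation_average_bound) simp
  then have "(LINT x|\<nu>. rotation_average A x) * (LINT x|\<nu>. rotation_average B x)
      \<le> (LINT x|\<nu>. rotation_average A x * rotation_average B x)"
    using rotation_average_bound
    by (intro M2.chebyshev_integral_inequality M2.integrable_const_bound[where B = 1]
        rotation_average_similarly_ordered A B AE_I2) auto
  then show ?thesis
    by (simp add: integral_rotation_average_eq_measure integral_measure_Int_rotation A B)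
qed

end

theorem proposition5:
  fixes m :: "(real ^ 'n ^ 'n) measure"
    and \<nu> :: "(real ^ 'n) measure"
    and A B :: "(real ^ 'n) set"
  assumes "normalized_haar_measure m"
    and "prob_space \<nu>" and "sets \<nu> = sets borel"
    and "rotation_invariant \<nu>"
    and "A \<in> sets borel" and "B \<in> sets borel"
    and "star_shaped_zero A" and "star_shaped_zero B"
  shows "(LINT U|m. measure \<nu> (A \<inter> (\<lambda>x. U *v x) ` B)) \<ge> measure \<nu> A * measure \<nu> B"
proof -
  have sets: "sets m = sets (restrict_space borel orthogonal_group)"
    using assms(1) by (simp add: normalized_haar_measure_def)
  \<comment> \<open>The normalization concerns \<open>orthogonal_group\<close>; it makes
    \<open>m\<close> a probability measure once this set is known to be the whole space.\<close>
  have "space m = orthogonal_group"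
    using sets_eq_imp_space_eq[OF sets] by (simp add: space_restrict_space)
  then have "prob_space m"
    using assms(1) by (intro prob_spaceI) (simp add: normalized_haar_measure_def)
  then have "haar_rotation m \<nu>"
    using assms by (simp add: haar_rotation_def haar_rotation_axioms_def pair_prob_space_def
        pair_sigma_finite_def prob_space_imp_sigma_finite)
  then show ?thesis
    using assms by (intro haar_rotation.integral_measure_Int_rotation_ge)
qed

end
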